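(* Let $M$ be a self-adjoint linear operator acting on functions of $x$ that commutes with $\partial_x$. If $u(x,t)$, $v(x,t)$ are smooth solutions of $$(v_t+uv_x)_x=0,\qquad Mu=v_x^2,$$ then $u$ satisfies $$m_t+m u_x+(mu)_x=0\qquad\text{with } m=Mu.$$ If $M=\partial_x^2$, this last equation is the Hunter-Saxton equation $$\left[(u_t+uu_x)_x-\tfrac12u_x^2\right]_x=0,$$ and if $M=\partial_x^2-1$, it is the Camassa-Holm equation $$\left[(u_t+uu_x)_x-\tfrac12u_x^2\right]_x=u_t+3uu_x.$$ Conversely, if $m=Mu>0$ is a smooth solution of $m_t+mu_x+(mu)_x=0$ and $v_x=\sqrt{m}$, then $(u,v)$ satisfies $(v_t+uv_x)_x=0$, $Mu=v_x^2$.
   Context: All functions are real-valued functions of $(x,t)$ in one space dimension; subscripts denote partial derivatives; $M$ acts in the $x$ variable only. *)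

theory Defs
  imports "HOL-Analysis.Analysis"
begin

section \<open>Functions of the space variable\<close>

definition smooth_fun :: "(real \<Rightarrow> real) \<Rightarrow> bool" where
  "smooth_fun f \<longleftrightarrow> (\<forall>n x. (deriv ^^ n) f differentiable (at x))"

definition smooth_funs :: "(real \<Rightarrow> real) set" where
  "smooth_funs = {f. smooth_fun f}"

definition test_funs :: "(real \<Rightarrow> real) set" where
  "test_funs = {f. smooth_fun f \<and> bounded {x. f x \<noteq> 0}}"

definition L2_pairing :: "(real \<Rightarrow> real) \<Rightarrow> (real \<Rightarrow> real) \<Rightarrow> real" where
  "L2_pairing f g = (LBINT x. f x * g x)"

text \<open>
  The operator is a total map on functions, but only its values on the domain \<open>D\<close> matter. The
  domain is a parameter so that non-local operators, which do not act on all smooth functions,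
  are covered as well. Self-adjointness is formal, that is, tested on compactly supported smooth
  functions: solutions \<open>u\<close> need not be square integrable (for the second derivative,
  \<open>M u = v\<^sub>x\<^sup>2\<close> makes \<open>u\<close> convex in \<open>x\<close>), so an \<open>L\<^sup>2\<close> domain would be too small.
\<close>

definition linear_operator_on ::
    "(real \<Rightarrow> real) set \<Rightarrow> ((real \<Rightarrow> real) \<Rightarrow> real \<Rightarrow> real) \<Rightarrow> bool" where
  "linear_operator_on D M \<longleftrightarrow>
     test_funs \<subseteq> D \<and> D \<subseteq> smooth_funs \<and>
     (\<forall>f\<in>D. M f \<in> smooth_funs) \<and>
     (\<forall>f\<in>D. \<forall>g\<in>D. \<forall>a b. (\<lambda>x. a * f x + b * g x) \<in> D \<and>
        M (\<lambda>x. a * f x + b * g x) = (\<lambda>x. a * M f x + b * M g x))"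

definition self_adjoint_on ::
    "(real \<Rightarrow> real) set \<Rightarrow> ((real \<Rightarrow> real) \<Rightarrow> real \<Rightarrow> real) \<Rightarrow> bool" where
  "self_adjoint_on D M \<longleftrightarrow>
     linear_operator_on D M \<and>
     (\<forall>f\<in>test_funs. \<forall>g\<in>test_funs. L2_pairing (M f) g = L2_pairing f (M g))"

definition commutes_with_dx ::
    "(real \<Rightarrow> real) set \<Rightarrow> ((real \<Rightarrow> real) \<Rightarrow> real \<Rightarrow> real) \<Rightarrow> bool" where
  "commutes_with_dx D M \<longleftrightarrow> (\<forall>f\<in>D. deriv f \<in> D \<and> M (deriv f) = deriv (M f))"

definition dxx :: "(real \<Rightarrow> real) \<Rightarrow> real \<Rightarrow> real" where
  "dxx f = deriv (deriv f)"

definition dxx_minus_id :: "(real \<Rightarrow> real) \<Rightarrow> real \<Rightarrow> real" where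
  "dxx_minus_id f = (\<lambda>x. deriv (deriv f) x - f x)"


text \<open>
  Both concrete operators satisfy the hypotheses on \<open>M\<close>, with the largest possible domain.
\<close>

lemma smooth_fun_deriv: "smooth_fun f \<Longrightarrow> smooth_fun (deriv f)"
  unfolding smooth_fun_def by (metis comp_apply funpow_Suc_right)

lemma smooth_fun_DERIV: "smooth_fun f \<Longrightarrow> (f has_real_derivative deriv f x) (at x)"
  unfolding smooth_fun_def
  by (metis DERIV_deriv_iff_real_differentiable funpow_0)

lemma deriv_lin:
  assumes "smooth_fun f" "smooth_fun g"
  shows "deriv (\<lambda>x. a * f x + b * g x) = (\<lambda>x. a * deriv f x + b * deriv g x)"
  by (rule ext, rule DERIV_imp_deriv)
    (auto intro!: derivative_eq_intros smooth_fun_DERIV assms)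

lemma funpow_deriv_lin:
  assumes "smooth_fun f" "smooth_fun g"
  shows "(deriv ^^ n) (\<lambda>x. a * f x + b * g x) =
    (\<lambda>x. a * (deriv ^^ n) f x + b * (deriv ^^ n) g x)"
  using assms
proof (induction n arbitrary: f g)
  case (Suc n)
  then show ?case
    by (simp add: funpow_Suc_right deriv_lin smooth_fun_deriv del: funpow.simps)
qed simp

lemma smooth_fun_lin:
  assumes "smooth_fun f" "smooth_fun g"
  shows "smooth_fun (\<lambda>x. a * f x + b * g x)"
  using assms unfolding smooth_fun_def funpow_deriv_lin[OF assms]
  by (auto intro!: derivative_intros)

lemma smooth_fun_continuous: "smooth_fun f \<Longrightarrow> continuous_on S f"
  by (meson DERIV_continuous_on has_field_derivative_at_within smooth_fun_DERIV)

lemma dxx_minus_const_admissible: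
  fixes c :: real
  defines "M \<equiv> (\<lambda>f x. deriv (deriv f) x - c * f x)"
  shows "self_adjoint_on smooth_funs M" "commutes_with_dx smooth_funs M"
proof -
  have Meq: "M f = (\<lambda>x. 1 * deriv (deriv f) x + (- c) * f x)" for f
    by (simp add: M_def)
  have Msm: "smooth_fun (M f)" if "smooth_fun f" for f
    unfolding Meq by (intro smooth_fun_lin smooth_fun_deriv that)
  have lin: "M (\<lambda>x. a * f x + b * g x) = (\<lambda>x. a * M f x + b * M g x)"
    if "smooth_fun f" "smooth_fun g" for a b f g
    using that by (simp add: M_def deriv_lin smooth_fun_deriv algebra_simps)
  show "commutes_with_dx smooth_funs M"
    unfolding commutes_with_dx_def smooth_funs_def Meq
    by (simp add: smooth_fun_deriv deriv_lin[of _ _ 1 "-c", simplified])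
  have "L2_pairing (M f) g = L2_pairing f (M g)" if "f \<in> test_funs" "g \<in> test_funs" for f g
  proof -
    have f: "smooth_fun f" and g: "smooth_fun g" and "bounded {x. f x \<noteq> 0}" "bounded {x. g x \<noteq> 0}"
      using that by (auto simp: test_funs_def)
    then obtain r where r: "r > 0" "\<And>x. f x \<noteq> 0 \<or> g x \<noteq> 0 \<Longrightarrow> \<bar>x\<bar> \<le> r"
    proof -
      have "bounded ({x. f x \<noteq> 0} \<union> {x. g x \<noteq> 0})"
        using \<open>bounded {x. f x \<noteq> 0}\<close> \<open>bounded {x. g x \<noteq> 0}\<close> by simp
      then obtain r where "r > 0" "\<forall>x\<in>{x. f x \<noteq> 0} \<union> {x. g x \<noteq> 0}. norm x \<le> r"
        unfolding bounded_pos by blast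
      then show ?thesis by (intro that[of r]) auto
    qed
    define s where "s = r + 1"
    have z: "f x = 0 \<and> g x = 0" if "\<bar>x\<bar> \<ge> s" for x
      using r(2)[of x] that by (force simp: s_def)
    define F where "F x = deriv f x * g x - f x * deriv g x" for x
    define F' where "F' x = M f x * g x - f x * M g x" for x
    have cont: "continuous_on S (M f)" "continuous_on S (M g)" "continuous_on S f" "continuous_on S g" for S
      by (intro smooth_fun_continuous Msm f g)+
    have dF: "(F has_real_derivative F' x) (at x)" for x
      unfolding F_def F'_def M_def
      by (auto intro!: derivative_eq_intros smooth_fun_DERIV smooth_fun_deriv f g simp: algebra_simps)
    have "has_bochner_integral lborel (\<lambda>x. indicator {-s..s} x *\<^sub>R F' x) (F s - F (-s))"
    proof (rule has_bochner_integral_FTC_Icc)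
      show "- s \<le> s" using r(1) by (simp add: s_def)
      show "(F has_vector_derivative F' x) (at x within {-s..s})" for x
        using dF by (simp add: has_real_derivative_iff_has_vector_derivative
            has_vector_derivative_at_within)
      show "continuous_on {-s..s} F'"
        unfolding F'_def by (intro continuous_intros cont)
    qed
    moreover have "F s - F (-s) = 0"
      using z[of s] z[of "-s"] r(1) by (simp add: F_def s_def)
    moreover have "(\<lambda>x. indicator {-s..s} x *\<^sub>R F' x) = F'"
    proof
      show "indicator {-s..s} x *\<^sub>R F' x = F' x" for x
        using z[of x] by (cases "\<bar>x\<bar> \<ge> s") (auto simp: F'_def indicator_def)
    qed
    ultimately have "(LBINT x. F' x) = 0"
      using has_bochner_integral_integral_eq by fastforce
    moreover have int: "integrable lborel h"
      if "continuous_on {-s..s} h" "\<And>x. \<bar>x\<bar> \<ge> s \<Longrightarrow> h x = 0" for h :: "real \<Rightarrow> real"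
    proof -
      have "set_integrable lborel {-s..s} h"
        by (rule borel_integrable_atLeastAtMost') (fact that)
      moreover have "(\<lambda>x. indicator {-s..s} x *\<^sub>R h x) = h"
      proof
        show "indicator {-s..s} x *\<^sub>R h x = h x" for x
          using that(2)[of x] by (cases "\<bar>x\<bar> \<ge> s") (auto simp: indicator_def)
      qed
      ultimately show ?thesis by (simp add: set_integrable_def)
    qed
    have "integrable lborel (\<lambda>x. M f x * g x)" "integrable lborel (\<lambda>x. f x * M g x)"
      by (rule int; simp add: z continuous_on_mult cont)+
    ultimately show ?thesis
      unfolding L2_pairing_def F'_def by simp
  qed
  then show "self_adjoint_on smooth_funs M"
    unfolding self_adjoint_on_def linear_operator_on_def
    using Msm lin by (auto simp: smooth_funs_def test_funs_def intro: smooth_fun_lin)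
qed

lemma dxx_admissible: "self_adjoint_on smooth_funs dxx" "commutes_with_dx smooth_funs dxx"
  using dxx_minus_const_admissible[of 0] by (simp_all add: dxx_def[abs_def])

lemma dxx_minus_id_admissible:
  "self_adjoint_on smooth_funs dxx_minus_id" "commutes_with_dx smooth_funs dxx_minus_id"
  using dxx_minus_const_admissible[of 1] by (simp_all add: dxx_minus_id_def[abs_def])


section \<open>Functions of space and time\<close>

text \<open>A function \<open>f\<close> of \<open>(x, t)\<close> is written in curried form, \<open>f x t\<close>.\<close>

definition dx :: "(real \<Rightarrow> real \<Rightarrow> real) \<Rightarrow> real \<Rightarrow> real \<Rightarrow> real" where
  "dx f = (\<lambda>x t. deriv (\<lambda>y. f y t) x)"

definition dt :: "(real \<Rightarrow> real \<Rightarrow> real) \<Rightarrow> real \<Rightarrow> real \<Rightarrow> real" where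
  "dt f = (\<lambda>x t. deriv (\<lambda>s. f x s) t)"

text \<open>
  Solutions live on all of space and on an open set \<open>T\<close> of times (solutions of these equations
  generally break down in finite time). \<open>Ck_on T k f\<close> says that \<open>f\<close> is of class \<open>C\<^sup>k\<close> on
  \<open>UNIV \<times> T\<close>.
\<close>

primrec Ck_on :: "real set \<Rightarrow> nat \<Rightarrow> (real \<Rightarrow> real \<Rightarrow> real) \<Rightarrow> bool" where
  "Ck_on T 0 f \<longleftrightarrow> continuous_on (UNIV \<times> T) (\<lambda>(x, t). f x t)"
| "Ck_on T (Suc k) f \<longleftrightarrow>
     (\<forall>x. \<forall>t\<in>T. (\<lambda>y. f y t) differentiable (at x) \<and> (\<lambda>s. f x s) differentiable (at t)) \<and>
     Ck_on T k (dx f) \<and> Ck_on T k (dt f)"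

definition smooth_xt :: "real set \<Rightarrow> (real \<Rightarrow> real \<Rightarrow> real) \<Rightarrow> bool" where
  "smooth_xt T f \<longleftrightarrow> (\<forall>k. Ck_on T k f)"

definition slices_in :: "(real \<Rightarrow> real) set \<Rightarrow> real set \<Rightarrow> (real \<Rightarrow> real \<Rightarrow> real) \<Rightarrow> bool" where
  "slices_in D T u \<longleftrightarrow> (\<forall>t\<in>T. (\<lambda>x. u x t) \<in> D)"

definition apply_x ::
    "((real \<Rightarrow> real) \<Rightarrow> real \<Rightarrow> real) \<Rightarrow> (real \<Rightarrow> real \<Rightarrow> real) \<Rightarrow> real \<Rightarrow> real \<Rightarrow> real" where
  "apply_x M u = (\<lambda>x t. M (\<lambda>y. u y t) x)"


section \<open>The equations\<close>

text \<open>
  In the first equation the outer \<open>x\<close>-derivative is required to exist, so that the equation is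
  not affected by the arbitrary values of \<^const>\<open>deriv\<close> at points of non-differentiability.
\<close>

definition uv_system ::
    "((real \<Rightarrow> real) \<Rightarrow> real \<Rightarrow> real) \<Rightarrow> real set \<Rightarrow>
     (real \<Rightarrow> real \<Rightarrow> real) \<Rightarrow> (real \<Rightarrow> real \<Rightarrow> real) \<Rightarrow> bool" where
  "uv_system M T u v \<longleftrightarrow>
     (\<forall>x. \<forall>t\<in>T.
        ((\<lambda>y. dt v y t + u y t * dx v y t) has_real_derivative 0) (at x) \<and>
        apply_x M u x t = (dx v x t)\<^sup>2)"

definition m_equation ::
    "real set \<Rightarrow> (real \<Rightarrow> real \<Rightarrow> real) \<Rightarrow> (real \<Rightarrow> real \<Rightarrow> real) \<Rightarrow> bool" where
  "m_equation T m u \<longleftrightarrow>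
     (\<forall>x. \<forall>t\<in>T. dt m x t + m x t * dx u x t + dx (\<lambda>x t. m x t * u x t) x t = 0)"

definition hs_expression :: "(real \<Rightarrow> real \<Rightarrow> real) \<Rightarrow> real \<Rightarrow> real \<Rightarrow> real" where
  "hs_expression u =
     dx (\<lambda>x t. dx (\<lambda>x t. dt u x t + u x t * dx u x t) x t - 1/2 * (dx u x t)\<^sup>2)"

definition hunter_saxton :: "real set \<Rightarrow> (real \<Rightarrow> real \<Rightarrow> real) \<Rightarrow> bool" where
  "hunter_saxton T u \<longleftrightarrow> (\<forall>x. \<forall>t\<in>T. hs_expression u x t = 0)"

definition camassa_holm :: "real set \<Rightarrow> (real \<Rightarrow> real \<Rightarrow> real) \<Rightarrow> bool" where
  "camassa_holm T u \<longleftrightarrow>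
     (\<forall>x. \<forall>t\<in>T. hs_expression u x t = dt u x t + 3 * u x t * dx u x t)"

end

theory Submission
  imports Defs
begin

text \<open>
  With \<open>m = v\<^sub>x\<^sup>2\<close>, the left-hand side \<open>m\<^sub>t + m u\<^sub>x + (m u)\<^sub>x\<close> equals \<open>2 v\<^sub>x (v\<^sub>t + u v\<^sub>x)\<^sub>x\<close> once the
  order of differentiation in \<open>v\<^sub>x\<^sub>t\<close> is exchanged; this gives both directions, since \<open>v\<^sub>x = \<surd>m\<close> does
  not vanish in the converse. Peano's form of the theorem on mixed partials is needed there, because
  \<open>v\<close> is only assumed differentiable in \<open>t\<close>: it derives the existence of \<open>v\<^sub>t\<^sub>x\<close> from the continuity
  of \<open>v\<^sub>x\<^sub>t\<close>. The two special cases are the same computation for \<open>u\<close> itself.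
\<close>

section \<open>Mixed partial derivatives\<close>

text \<open>The second difference of \<open>v\<close> over the rectangle with opposite corners (x,
  t) and (x + h, t + k), divided by hk, is a value of \<open>z\<close> inside the rectangle: apply
  the mean value theorem in x (through \<open>w\<close>), then in t. Letting k tend to 0 first turns
  it into the difference quotient of \<open>dt v\<close> in x; continuity of \<open>z\<close> then
  handles h.\<close>

lemma DERIV_mixed_partial:
  fixes v w z :: "real \<Rightarrow> real \<Rightarrow> real"
  assumes T: "open T" "t \<in> T"
    and vx: "\<And>y s. s \<in> T \<Longrightarrow> ((\<lambda>y. v y s) has_real_derivative w y s) (at y)"
    and wt: "\<And>y s. s \<in> T \<Longrightarrow> ((\<lambda>s. w y s) has_real_derivative z y s) (at s)"
    and vt: "\<And>y. (\<lambda>s. v y s) differentiable (at t)"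
    and z: "continuous_on (UNIV \<times> T) (\<lambda>(y, s). z y s)"
  shows "((\<lambda>y. dt v y t) has_real_derivative z x t) (at x)"
proof -
  have vtd: "((\<lambda>s. v y s) has_real_derivative dt v y t) (at t)" for y
    using vt by (simp add: dt_def DERIV_deriv_iff_real_differentiable)
  have "isCont (\<lambda>(y, s). z y s) (x, t)"
    using z T by (simp add: continuous_on_eq_continuous_at open_Times)
  have bound: "\<exists>d>0. \<forall>h. h \<noteq> 0 \<and> \<bar>h\<bar> < d \<longrightarrow>
      \<bar>(dt v (x + h) t - dt v x t) / h - z x t\<bar> \<le> e" if "e > 0" for e
  proof -
    obtain d1 where d1: "d1 > 0" "\<And>p. dist p (x, t) < d1 \<Longrightarrow> dist (z (fst p) (snd p)) (z x t) < e"
      using \<open>isCont _ _\<close> \<open>e > 0\<close> unfolding continuous_at_eps_delta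
      by (metis (no_types, lifting) case_prod_unfold fst_conv snd_conv)
    obtain d2 where d2: "d2 > 0" "ball t d2 \<subseteq> T"
      using T openE by blast
    \<comment> \<open>Halving \<open>d1\<close> allows for the distance in the plane being bounded
      by the sum of the two coordinate distances; \<open>d2\<close> keeps the times inside
      \<open>T\<close>.\<close>
    define d where "d = min (d1 / 2) d2"
    have "d > 0" using d1 d2 by (simp add: d_def)
    have inT: "s \<in> T" if "\<bar>s - t\<bar> < d" for s
      using that d2 by (auto simp: d_def dist_real_def subset_iff abs_minus_commute)
    have zd: "\<bar>z y s - z x t\<bar> < e" if "\<bar>y - x\<bar> < d" "\<bar>s - t\<bar> < d" for y s
    proof -
      have "dist (y, s) (x, t) \<le> \<bar>y - x\<bar> + \<bar>s - t\<bar>"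
        using sqrt_sum_squares_le_sum_abs[of "y - x" "s - t"] by (simp add: dist_Pair_Pair dist_real_def)
      then show ?thesis
        using d1(2)[of "(y, s)"] that by (simp add: d_def dist_real_def)
    qed
    \<comment> \<open>A form of the mean value theorem that is insensitive to the sign of the
      increment, since \<open>h\<close> and \<open>k\<close> below may be negative.\<close>
    have MVT: "\<exists>\<xi>. \<bar>\<xi> - a\<bar> \<le> \<bar>h\<bar> \<and> f (a + h) - f a = h * f' \<xi>"
      if der: "\<And>y. \<bar>y - a\<bar> \<le> \<bar>h\<bar> \<Longrightarrow> (f has_real_derivative f' y) (at y)" for f f' and a h :: real
    proof (cases h "0 :: real" rule: linorder_cases)
      case less
      then obtain \<xi> where "a + h < \<xi>" "\<xi> < a" "f a - f (a + h) = (a - (a + h)) * f' \<xi>"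
        using MVT2[of "a + h" a f f'] der by auto
      then show ?thesis using less by (intro exI[of _ \<xi>]) (auto simp: algebra_simps)
    next
      case greater
      then obtain \<xi> where "a < \<xi>" "\<xi> < a + h" "f (a + h) - f a = (a + h - a) * f' \<xi>"
        using MVT2[of a "a + h" f f'] der by auto
      then show ?thesis by (intro exI[of _ \<xi>]) auto
    qed (auto intro: exI[of _ a])
    have quot: "\<bar>((v (x + h) (t + k) - v (x + h) t) / k - (v x (t + k) - v x t) / k) / h - z x t\<bar> \<le> e"
      if h: "h \<noteq> 0" "\<bar>h\<bar> < d" and k: "k \<noteq> 0" "\<bar>k\<bar> < d" for h k
    proof -
      have "\<bar>t + k - t\<bar> < d" "\<bar>t - t\<bar> < d" using k \<open>d > 0\<close> by auto
      note inT' = this[THEN inT]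
      \<comment> \<open>The second difference is the x-increment of the function taking y to
        \<open>v y (t + k) - v y t\<close>, so one point \<xi> serves both times.\<close>
      obtain \<xi> where \<xi>: "\<bar>\<xi> - x\<bar> \<le> \<bar>h\<bar>"
        "(v (x + h) (t + k) - v (x + h) t) - (v x (t + k) - v x t) = h * (w \<xi> (t + k) - w \<xi> t)"
        using MVT[of x h "\<lambda>y. v y (t + k) - v y t" "\<lambda>y. w y (t + k) - w y t",
            OF DERIV_diff[OF vx[OF inT'(1)] vx[OF inT'(2)]]] by auto
      obtain \<tau> where \<tau>: "\<bar>\<tau> - t\<bar> \<le> \<bar>k\<bar>" "w \<xi> (t + k) - w \<xi> t = k * z \<xi> \<tau>"
        using MVT[of t k "w \<xi>" "z \<xi>"] wt inT k by force
      have "((v (x + h) (t + k) - v (x + h) t) / k - (v x (t + k) - v x t) / k) / h = z \<xi> \<tau>"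
        using \<xi>(2) \<tau>(2) h k by (simp add: diff_divide_distrib [symmetric])
      then show ?thesis using zd[of \<xi> \<tau>] \<xi>(1) \<tau>(1) h k by simp
    qed
    show ?thesis
    proof (intro exI conjI allI impI)
      fix h assume h: "h \<noteq> 0 \<and> \<bar>h\<bar> < d"
      \<comment> \<open>The limit in \<open>k\<close> is taken with \<open>h\<close> fixed; the
        bound \<open>e\<close> is uniform in \<open>k\<close> and survives as a non-strict
        inequality.\<close>
      have "((\<lambda>k. \<bar>((v (x + h) (t + k) - v (x + h) t) / k - (v x (t + k) - v x t) / k) / h - z x t\<bar>)
        \<longlongrightarrow> \<bar>(dt v (x + h) t - dt v x t) / h - z x t\<bar>) (at 0)"
        using vtd[of x] vtd[of "x + h"] h unfolding DERIV_def by (intro tendsto_intros) auto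
      moreover have "eventually (\<lambda>k. \<bar>((v (x + h) (t + k) - v (x + h) t) / k
          - (v x (t + k) - v x t) / k) / h - z x t\<bar> \<le> e) (at 0)"
        unfolding eventually_at using quot h \<open>d > 0\<close> by (intro exI[of _ d]) (auto simp: dist_real_def)
      ultimately show "\<bar>(dt v (x + h) t - dt v x t) / h - z x t\<bar> \<le> e"
        by (rule tendsto_upperbound) simp
    qed fact
  qed
  show ?thesis
    unfolding DERIV_def LIM_eq
  proof (intro allI impI)
    fix e :: real assume "e > 0"
    \<comment> \<open>Passing to \<open>e / 2\<close> recovers the strict inequality in the
      definition of the limit.\<close>
    then obtain d where "d > 0" "\<forall>h. h \<noteq> 0 \<and> \<bar>h\<bar> < d \<longrightarrow>
      \<bar>(dt v (x + h) t - dt v x t) / h - z x t\<bar> \<le> e / 2"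
      using bound[of "e / 2"] by auto
    then show "\<exists>d>0. \<forall>h. h \<noteq> 0 \<and> norm (h - 0) < d \<longrightarrow>
        norm ((dt v (x + h) t - dt v x t) / h - z x t) < e"
      using \<open>e > 0\<close> by (intro exI[of _ d]) force
  qed
qed

section \<open>Calculus of smooth functions of space and time\<close>

lemma smooth_xt_dx: "smooth_xt T f \<Longrightarrow> smooth_xt T (dx f)"
  and smooth_xt_dt: "smooth_xt T f \<Longrightarrow> smooth_xt T (dt f)"
  and smooth_xt_continuous: "smooth_xt T f \<Longrightarrow> continuous_on (UNIV \<times> T) (\<lambda>(x, t). f x t)"
  unfolding smooth_xt_def by (metis Ck_on.simps)+

lemma smooth_xt_DERIV_x:
    "smooth_xt T f \<Longrightarrow> t \<in> T \<Longrightarrow> ((\<lambda>y. f y t) has_real_derivative dx f x t) (at x)"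
  and smooth_xt_DERIV_t:
    "smooth_xt T f \<Longrightarrow> t \<in> T \<Longrightarrow> ((\<lambda>s. f x s) has_real_derivative dt f x t) (at t)"
  unfolding smooth_xt_def dx_def dt_def DERIV_deriv_iff_real_differentiable
  by (metis Ck_on.simps(2))+

lemma dx_eqI: "((\<lambda>y. f y t) has_real_derivative d) (at x) \<Longrightarrow> dx f x t = d"
  and dt_eqI: "((\<lambda>s. f x s) has_real_derivative d) (at t) \<Longrightarrow> dt f x t = d"
  by (simp_all add: dx_def dt_def DERIV_imp_deriv)

text \<open>Agreement on \<open>T\<close> passes to \<open>dx\<close> because whole x-slices
  coincide, and to \<open>dt\<close> because openness of \<open>T\<close> gives agreement at all
  nearby times. This transfers regularity from an explicit formula to a function that matches it
  only for times in \<open>T\<close>.\<close>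

lemma Ck_on_cong:
  assumes "open T" "\<And>x t. t \<in> T \<Longrightarrow> f x t = g x t" "Ck_on T k f"
  shows "Ck_on T k g"
  using assms(2,3)
proof (induction k arbitrary: f g)
  case 0
  then show ?case by (auto elim!: continuous_on_eq)
next
  case (Suc k)
  have x: "(\<lambda>y. f y t) = (\<lambda>y. g y t)" if "t \<in> T" for t
    using that Suc.prems(1) by auto
  have ev: "eventually (\<lambda>s. f x s = g x s) (nhds t)" if "t \<in> T" for x t
    using that Suc.prems(1) \<open>open T\<close> eventually_nhds by blast
  have "dx f x t = dx g x t" if "t \<in> T" for x t
    using x[OF that] by (simp add: dx_def)
  moreover have "dt f x t = dt g x t" if "t \<in> T" for x t
    unfolding dt_def by (rule deriv_cong_ev[OF ev[OF that]]) simp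
  moreover have "(\<lambda>s. g x s) differentiable (at t)" if "t \<in> T" for x t
  proof -
    have "((\<lambda>s. f x s) has_real_derivative dt f x t) (at t)"
      using Suc.prems(2) that by (simp add: dt_def DERIV_deriv_iff_real_differentiable)
    then have "((\<lambda>s. g x s) has_real_derivative dt f x t) (at t)"
      using DERIV_cong_ev[OF refl ev[OF that] refl] by blast
    then show ?thesis by (auto simp: real_differentiable_def)
  qed
  ultimately show ?case
    using Suc.prems(2) Suc.IH[of "dx f" "dx g"] Suc.IH[of "dt f" "dt g"] by (auto simp: x[symmetric])
qed

lemma smooth_xt_cong:
  "open T \<Longrightarrow> (\<And>x t. t \<in> T \<Longrightarrow> f x t = g x t) \<Longrightarrow> smooth_xt T f \<Longrightarrow> smooth_xt T g"
  using Ck_on_cong unfolding smooth_xt_def by blast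

text \<open>Kept at a fixed order \<open>k\<close> because the induction for products needs it for
  the two Leibniz terms, which are known only to be of class \<open>k\<close> at that stage.\<close>

lemma Ck_on_add:
  assumes "open T" "Ck_on T k f" "Ck_on T k g"
  shows "Ck_on T k (\<lambda>x t. f x t + g x t)"
  using assms(2,3)
proof (induction k arbitrary: f g)
  case 0
  then show ?case by (auto simp: case_prod_unfold intro: continuous_intros)
next
  case (Suc k)
  have "dx f x t + dx g x t = dx (\<lambda>x t. f x t + g x t) x t"
    "dt f x t + dt g x t = dt (\<lambda>x t. f x t + g x t) x t" if "t \<in> T" for x t
    unfolding dx_def dt_def using that Suc.prems
    by (auto intro!: DERIV_imp_deriv[symmetric] DERIV_add
        simp: DERIV_deriv_iff_real_differentiable)
  then have "Ck_on T k (dx (\<lambda>x t. f x t + g x t))" "Ck_on T k (dt (\<lambda>x t. f x t + g x t))"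
    using Suc.prems
      Ck_on_cong[OF \<open>open T\<close> _ Suc.IH[of "dx f" "dx g"], of "dx (\<lambda>x t. f x t + g x t)"]
      Ck_on_cong[OF \<open>open T\<close> _ Suc.IH[of "dt f" "dt g"], of "dt (\<lambda>x t. f x t + g x t)"]
    by auto
  then show ?case
    using Suc.prems by (auto intro: derivative_intros)
qed

text \<open>Induction on the order by the Leibniz rule. The factors are assumed smooth, not merely
  of class \<open>k\<close>, so a factor and the derivative of the other again satisfy the induction
  hypothesis without any count of orders.\<close>

lemma smooth_xt_mult:
  assumes "open T" "smooth_xt T f" "smooth_xt T g"
  shows "smooth_xt T (\<lambda>x t. f x t * g x t)"
proof -
  have "Ck_on T k (\<lambda>x t. f x t * g x t)" for k
    using assms(2,3)
  proof (induction k arbitrary: f g)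
    case 0
    then show ?case
      by (auto simp: case_prod_unfold intro!: continuous_intros dest!: smooth_xt_continuous)
  next
    case (Suc k)
    note d = smooth_xt_DERIV_x[OF Suc.prems(1)] smooth_xt_DERIV_x[OF Suc.prems(2)]
      smooth_xt_DERIV_t[OF Suc.prems(1)] smooth_xt_DERIV_t[OF Suc.prems(2)]
    have "dx f x t * g x t + f x t * dx g x t = dx (\<lambda>x t. f x t * g x t) x t"
      "dt f x t * g x t + f x t * dt g x t = dt (\<lambda>x t. f x t * g x t) x t" if "t \<in> T" for x t
      by (rule dx_eqI[symmetric] dt_eqI[symmetric]; auto intro!: derivative_eq_intros d that)+
    moreover have "Ck_on T k (\<lambda>x t. dx f x t * g x t + f x t * dx g x t)"
      "Ck_on T k (\<lambda>x t. dt f x t * g x t + f x t * dt g x t)"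
      using Suc by (auto intro!: Ck_on_add[OF \<open>open T\<close>] Suc.IH smooth_xt_dx smooth_xt_dt)
    ultimately have "Ck_on T k (dx (\<lambda>x t. f x t * g x t))" "Ck_on T k (dt (\<lambda>x t. f x t * g x t))"
      using Ck_on_cong[OF \<open>open T\<close>, of "\<lambda>x t. dx f x t * g x t + f x t * dx g x t"]
        Ck_on_cong[OF \<open>open T\<close>, of "\<lambda>x t. dt f x t * g x t + f x t * dt g x t"] by simp_all
    then show ?case
      using Suc.prems by (auto simp: smooth_xt_def dest!: spec[of _ "Suc 0"] intro!: derivative_intros)
  qed
  then show ?thesis by (simp add: smooth_xt_def)
qed

text \<open>Used below to bring every mixed derivative to the form with \<open>dt\<close>
  outermost.\<close>

lemma smooth_xt_DERIV_dt_x: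
  assumes "open T" "smooth_xt T f" "t \<in> T"
  shows "((\<lambda>y. dt f y t) has_real_derivative dt (dx f) x t) (at x)"
proof (rule DERIV_mixed_partial[where T = T and w = "dx f"])
  show "(\<lambda>s. f y s) differentiable (at t)" for y
    using smooth_xt_DERIV_t[OF assms(2,3)] by (auto simp: real_differentiable_def)
qed (use assms in \<open>auto intro: smooth_xt_DERIV_x smooth_xt_DERIV_t
    smooth_xt_continuous smooth_xt_dx smooth_xt_dt\<close>)

section \<open>The system and the equation for m, in both directions\<close>

lemma uv_system_imp_m_equation:
  assumes T: "open T" and u: "smooth_xt T u" and v: "smooth_xt T v" and uv: "uv_system M T u v"
  shows "smooth_xt T (apply_x M u)" "m_equation T (apply_x M u) u"
proof -
  have m: "apply_x M u x t = dx v x t * dx v x t" if "t \<in> T" for x t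
    using uv that by (simp add: uv_system_def power2_eq_square)
  \<comment> \<open>\<open>M\<close> acts on each time slice separately; regularity in time is
    inherited from the product \<open>dx v x t * dx v x t\<close>.\<close>
  show sm: "smooth_xt T (apply_x M u)"
    using smooth_xt_cong[OF T _ smooth_xt_mult[OF T smooth_xt_dx[OF v] smooth_xt_dx[OF v]]] m
    by metis
  show "m_equation T (apply_x M u) u"
    unfolding m_equation_def
  proof (intro allI ballI)
    fix x t assume t: "t \<in> T"
    note D = smooth_xt_DERIV_x[OF u t] smooth_xt_DERIV_x[OF smooth_xt_dx[OF v] t]
      smooth_xt_DERIV_t[OF smooth_xt_dx[OF v] t] smooth_xt_DERIV_dt_x[OF T v t]
    \<comment> \<open>The identity is available only for times in \<open>T\<close>; the time
      derivative needs it on a neighbourhood of \<open>t\<close>.\<close>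
    have ev: "eventually (\<lambda>s. apply_x M u x s = dx v x s * dx v x s) (nhds t)"
      using m t T eventually_nhds by blast
    have mt: "dt (apply_x M u) x t = 2 * dx v x t * dt (dx v) x t"
    proof (rule dt_eqI)
      show "((\<lambda>s. apply_x M u x s) has_real_derivative 2 * dx v x t * dt (dx v) x t) (at t)"
        unfolding DERIV_cong_ev[OF refl ev refl]
        by (auto intro!: derivative_eq_intros D)
    qed
    have mx: "dx (\<lambda>x t. apply_x M u x t * u x t) x t =
        2 * dx v x t * dx (dx v) x t * u x t + dx v x t * dx v x t * dx u x t"
      by (rule dx_eqI) (auto simp: m[OF t] algebra_simps intro!: derivative_eq_intros D)
    have "((\<lambda>y. dt v y t + u y t * dx v y t) has_real_derivative
        dt (dx v) x t + (dx u x t * dx v x t + u x t * dx (dx v) x t)) (at x)"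
      by (auto intro!: derivative_eq_intros D)
    moreover have "((\<lambda>y. dt v y t + u y t * dx v y t) has_real_derivative 0) (at x)"
      using uv t by (simp add: uv_system_def)
    ultimately have "dt (dx v) x t + (dx u x t * dx v x t + u x t * dx (dx v) x t) = 0"
      using DERIV_unique by blast
    moreover have "dt (apply_x M u) x t + apply_x M u x t * dx u x t
        + dx (\<lambda>x t. apply_x M u x t * u x t) x t =
      2 * dx v x t * (dt (dx v) x t + (dx u x t * dx v x t + u x t * dx (dx v) x t))"
      unfolding mt mx m[OF t] by (simp add: algebra_simps)
    ultimately show "dt (apply_x M u) x t + apply_x M u x t * dx u x t
        + dx (\<lambda>x t. apply_x M u x t * u x t) x t = 0" by simp
  qed
qed

text \<open>Positivity makes \<open>sqrt\<close> smooth along m, so the time derivative m_t / (2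
  sqrt m) of v_x is continuous and v_tx exists. Then (v_t + u v_x)_x equals (m_t + 2 m u_x + u m_x)
  / (2 sqrt m), whose numerator is the equation for m.\<close>

lemma m_equation_imp_uv_system:
  assumes T: "open T" and u: "smooth_xt T u" and m: "smooth_xt T (apply_x M u)"
    and pos: "\<And>x t. t \<in> T \<Longrightarrow> apply_x M u x t > 0"
    and eq: "m_equation T (apply_x M u) u"
    and vt: "\<And>x t. t \<in> T \<Longrightarrow> (\<lambda>s. v x s) differentiable (at t)"
    and vx: "\<And>x t. t \<in> T \<Longrightarrow> ((\<lambda>y. v y t) has_real_derivative sqrt (apply_x M u x t)) (at x)"
  shows "uv_system M T u v"
  unfolding uv_system_def
proof (intro allI ballI conjI)
  fix x t assume t: "t \<in> T"
  define m where "m = apply_x M u"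
  note pos = pos[folded m_def] and m = m[folded m_def]
  have v: "dx v y t = sqrt (m y t)" for y
    unfolding m_def by (rule dx_eqI) (rule vx[OF t])
  show "apply_x M u x t = (dx v x t)\<^sup>2"
    using pos[OF t, of x] by (simp add: v m_def)
  note D = smooth_xt_DERIV_x[OF u t] smooth_xt_DERIV_x[OF m t]
  have "((\<lambda>y. dt v y t) has_real_derivative dt m x t / (2 * sqrt (m x t))) (at x)"
  proof (rule DERIV_mixed_partial[OF T t, where w = "\<lambda>y s. sqrt (m y s)"
        and z = "\<lambda>y s. dt m y s / (2 * sqrt (m y s))"])
    show "((\<lambda>s. sqrt (m y s)) has_real_derivative dt m y s / (2 * sqrt (m y s))) (at s)"
      if "s \<in> T" for y s
      using pos[OF that, of y]
      by (auto intro!: derivative_eq_intros smooth_xt_DERIV_t[OF m that] simp: field_simps)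
    show "continuous_on (UNIV \<times> T) (\<lambda>(y, s). dt m y s / (2 * sqrt (m y s)))"
      using smooth_xt_continuous[OF m] smooth_xt_continuous[OF smooth_xt_dt[OF m]] pos
      by (auto simp: case_prod_unfold less_imp_neq[symmetric] intro!: continuous_intros)
  qed (use vx vt t in \<open>auto simp: m_def\<close>)
  moreover have "((\<lambda>y. u y t * dx v y t) has_real_derivative
      dx u x t * sqrt (m x t) + u x t * (dx m x t / (2 * sqrt (m x t)))) (at x)"
    unfolding v using pos[OF t, of x] by (auto intro!: derivative_eq_intros D simp: field_simps)
  ultimately have "((\<lambda>y. dt v y t + u y t * dx v y t) has_real_derivative
      dt m x t / (2 * sqrt (m x t)) +
      (dx u x t * sqrt (m x t) + u x t * (dx m x t / (2 * sqrt (m x t))))) (at x)"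
    by (rule DERIV_add)
  moreover have "dt m x t / (2 * sqrt (m x t)) +
      (dx u x t * sqrt (m x t) + u x t * (dx m x t / (2 * sqrt (m x t)))) = 0"
  proof -
    have "dx (\<lambda>x t. m x t * u x t) x t = dx m x t * u x t + m x t * dx u x t"
      by (rule dx_eqI) (auto intro!: derivative_eq_intros D)
    then have "dt m x t + 2 * m x t * dx u x t + u x t * dx m x t = 0"
      using eq[unfolded m_equation_def m_def[symmetric], rule_format, OF t, of x]
      by (simp add: algebra_simps)
    \<comment> \<open>These facts allow clearing the denominator \<open>2 * sqrt (m x t)\<close> and
      matching the u_x term.\<close>
    moreover have "sqrt (m x t) * sqrt (m x t) = m x t" "sqrt (m x t) > 0"
      using pos[OF t, of x] by simp_all
    ultimately show ?thesis
      by (simp add: field_simps)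
  qed
  ultimately show "((\<lambda>y. dt v y t + u y t * dx v y t) has_real_derivative 0) (at x)"
    by simp
qed

section \<open>The Hunter-Saxton and Camassa-Holm equations\<close>

text \<open>The right-hand side is m_t + m u_x + (m u)_x for m = u_xx, expanded.\<close>

lemma hs_expression_eq:
  assumes T: "open T" and u: "smooth_xt T u" and t: "t \<in> T"
  shows "hs_expression u x t = dt (dx (dx u)) x t + 2 * dx u x t * dx (dx u) x t
    + u x t * dx (dx (dx u)) x t"
proof -
  note ux = smooth_xt_dx[OF u] and uxx = smooth_xt_dx[OF smooth_xt_dx[OF u]]
  note D = smooth_xt_DERIV_x[OF u t] smooth_xt_DERIV_x[OF ux t] smooth_xt_DERIV_x[OF uxx t]
    smooth_xt_DERIV_dt_x[OF T u t] smooth_xt_DERIV_dt_x[OF T ux t]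
  \<comment> \<open>Stated for all \<open>y\<close> at the fixed time, so that it can be rewritten
    under the outer x-derivative.\<close>
  have "dx (\<lambda>x t. dt u x t + u x t * dx u x t) y t - 1/2 * (dx u y t)\<^sup>2 =
      dt (dx u) y t + 1/2 * (dx u y t)\<^sup>2 + u y t * dx (dx u) y t" for y
  proof -
    have "dx (\<lambda>x t. dt u x t + u x t * dx u x t) y t =
        dt (dx u) y t + (dx u y t)\<^sup>2 + u y t * dx (dx u) y t"
      by (rule dx_eqI) (auto intro!: derivative_eq_intros D simp: power2_eq_square)
    then show ?thesis by simp
  qed
  then show ?thesis
    unfolding hs_expression_def
    by (intro dx_eqI) (auto intro!: derivative_eq_intros D simp: algebra_simps)
qed

text \<open>One parameter covers both operators: the term -c u of m adds -c (u_t + u u_x + (u^2)_x)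
  = -c (u_t + 3 u u_x) to the expression for u_xx.\<close>

lemma m_equation_dxx_minus_const:
  assumes T: "open T" and u: "smooth_xt T u"
  shows "m_equation T (\<lambda>x t. dx (dx u) x t - c * u x t) u \<longleftrightarrow>
    (\<forall>x. \<forall>t\<in>T. hs_expression u x t = c * (dt u x t + 3 * u x t * dx u x t))"
proof -
  note uxx = smooth_xt_dx[OF smooth_xt_dx[OF u]]
  have "dt (\<lambda>x t. dx (dx u) x t - c * u x t) x t
      + (dx (dx u) x t - c * u x t) * dx u x t
      + dx (\<lambda>x t. (dx (dx u) x t - c * u x t) * u x t) x t =
    hs_expression u x t - c * (dt u x t + 3 * u x t * dx u x t)" if t: "t \<in> T" for x t
  proof -
    note D = smooth_xt_DERIV_x[OF u t] smooth_xt_DERIV_x[OF uxx t]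
      smooth_xt_DERIV_t[OF u t] smooth_xt_DERIV_t[OF uxx t]
    have "dt (\<lambda>x t. dx (dx u) x t - c * u x t) x t = dt (dx (dx u)) x t - c * dt u x t"
      by (rule dt_eqI) (auto intro!: derivative_eq_intros D)
    moreover have "dx (\<lambda>x t. (dx (dx u) x t - c * u x t) * u x t) x t =
        (dx (dx (dx u)) x t - c * dx u x t) * u x t + (dx (dx u) x t - c * u x t) * dx u x t"
      by (rule dx_eqI) (auto intro!: derivative_eq_intros D)
    ultimately show ?thesis
      by (simp add: hs_expression_eq[OF T u t] algebra_simps)
  qed
  then show ?thesis
    by (simp add: m_equation_def)
qed

theorem mainTheorem4:
  fixes D :: "(real \<Rightarrow> real) set"
    and M :: "(real \<Rightarrow> real) \<Rightarrow> real \<Rightarrow> real"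
    and T :: "real set"
  assumes "self_adjoint_on D M"
    and "commutes_with_dx D M"
    and "open T"
  shows
    "(\<forall>u v. smooth_xt T u \<and> smooth_xt T v \<and> slices_in D T u \<and> uv_system M T u v \<longrightarrow>
        smooth_xt T (apply_x M u) \<and> m_equation T (apply_x M u) u) \<and>
     (\<forall>u. smooth_xt T u \<longrightarrow>
        (m_equation T (apply_x dxx u) u \<longleftrightarrow> hunter_saxton T u)) \<and>
     (\<forall>u. smooth_xt T u \<longrightarrow>
        (m_equation T (apply_x dxx_minus_id u) u \<longleftrightarrow> camassa_holm T u)) \<and>
     (\<forall>u v. smooth_xt T u \<and> slices_in D T u \<and> smooth_xt T (apply_x M u) \<and>
        (\<forall>x. \<forall>t\<in>T. apply_x M u x t > 0) \<and>
        m_equation T (apply_x M u) u \<and>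
        (\<forall>x. \<forall>t\<in>T. (\<lambda>s. v x s) differentiable (at t)) \<and>
        (\<forall>x. \<forall>t\<in>T. ((\<lambda>y. v y t) has_real_derivative sqrt (apply_x M u x t)) (at x)) \<longrightarrow>
        uv_system M T u v)"
proof (intro conjI allI impI; (elim conjE)?)
  fix u assume u: "smooth_xt T u"
  \<comment> \<open>The factor 0 exhibits \<open>dxx\<close> as the member c = 0 of the
    family.\<close>
  have "apply_x dxx u = (\<lambda>x t. dx (dx u) x t - 0 * u x t)"
    by (simp add: apply_x_def dxx_def dx_def)
  then show "m_equation T (apply_x dxx u) u \<longleftrightarrow> hunter_saxton T u"
    using m_equation_dxx_minus_const[OF \<open>open T\<close> u, of 0] by (simp add: hunter_saxton_def)
  have "apply_x dxx_minus_id u = (\<lambda>x t. dx (dx u) x t - 1 * u x t)"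
    by (simp add: apply_x_def dxx_minus_id_def dx_def)
  then show "m_equation T (apply_x dxx_minus_id u) u \<longleftrightarrow> camassa_holm T u"
    using m_equation_dxx_minus_const[OF \<open>open T\<close> u, of 1] by (simp add: camassa_holm_def)
qed (use \<open>open T\<close> in \<open>blast intro: uv_system_imp_m_equation m_equation_imp_uv_system\<close>)+

end
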